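(* There exists a consecutive polynomial sequence $\{f_n\}$ over $\mathbb{F}_q$ of length $$H \ge \left\lfloor \sqrt{2(q-1)} + \tfrac{3}{2} \right\rfloor$$ such that all the terms in the sequence are pairwise coprime.
   Context: Let $p$ be an odd prime, $q=p^s$ with $s\ge 1$ an integer, and $\mathbb{F}_q$ the finite field with $q$ elements. A consecutive polynomial sequence of length $H$ over $\mathbb{F}_q$ is a sequence $f_1,\ldots,f_H$ with $f_n=u_nX^n+\cdots+u_1X+u_0\in\mathbb{F}_q[X]$ for $1\le n\le H$, where $u_0,u_1,\ldots,u_H$ are non-zero elements of $\mathbb{F}_q$. *)

theory Defs
  imports Complex_Main "HOL-Library.Cardinality" "HOL-Computational_Algebra.Computational_Algebra"
begin

text \<open>Only the values \<open>f 1, \<dots>, f H\<close> belong to the sequence; \<open>f\<close> is unconstrained elsewhere.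
  One coefficient sequence \<open>u\<close>, non-zero on \<open>0, \<dots>, H\<close>, serves all the terms.\<close>

definition consecutive_poly_seq :: "nat \<Rightarrow> (nat \<Rightarrow> 'a::field poly) \<Rightarrow> bool" where
  "consecutive_poly_seq H f \<longleftrightarrow>
     (\<exists>u :: nat \<Rightarrow> 'a. (\<forall>i\<le>H. u i \<noteq> 0) \<and> (\<forall>n\<in>{1..H}. f n = (\<Sum>i\<le>n. monom (u i) i)))"

end

theory Submission
  imports Defs
begin

text \<open>The coefficients are chosen greedily. Given pairwise coprime \<open>f\<^sub>1, \<dots>, f\<^sub>N\<close>, the next term is
  \<open>f\<^sub>N + c X\<^bsup>N+1\<^esup>\<close>. It is coprime to \<open>f\<^sub>N\<close> for every \<open>c \<noteq> 0\<close>, and for \<open>m < N\<close> it fails to be coprime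
  to \<open>f\<^sub>m\<close> for at most \<open>m\<close> values of \<open>c\<close>: a prime factor of \<open>f\<^sub>m\<close> cannot divide the
  new term for two different \<open>c\<close>, since it would divide a power of \<open>X\<close> while \<open>f\<^sub>m(0) \<noteq> 0\<close>.
  So a good \<open>c\<close> exists as long as \<open>1 + N(N-1)/2 < q\<close>.\<close>

text \<open>Among the non-unit divisors of a common non-unit divisor \<open>e\<close>, one of least
  degree is irreducible: in a factorization \<open>a * b\<close> with \<open>b\<close> a non-unit,
  minimality forces \<open>degree a = 0\<close>. Over a field irreducible polynomials are
  prime.\<close>

lemma not_coprime_prime_elem_divisor:
  fixes f g :: "'a::field poly"
  assumes "\<not> coprime f g" "f \<noteq> 0"
  obtains d where "prime_elem d" "d dvd f" "d dvd g"
proof -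
  obtain e where e: "e dvd f" "e dvd g" "\<not> is_unit e"
    using assms(1) by (meson coprimeI)
  with assms(2) have "e \<noteq> 0" by auto
  define P where "P d \<longleftrightarrow> d dvd e \<and> \<not> is_unit d" for d
  define d where "d = arg_min degree P"
  have "P e" using e(3) by (simp add: P_def)
  then have "P d" and min: "\<And>b. P b \<Longrightarrow> degree d \<le> degree b"
    unfolding d_def by (auto intro: arg_min_natI arg_min_nat_le)
  then have d: "d dvd e" "\<not> is_unit d" "d \<noteq> 0"
    using \<open>e \<noteq> 0\<close> by (auto simp: P_def)
  have "irreducible d"
  proof (rule irreducibleI)
    fix a b assume ab: "d = a * b"
    then have nz: "a \<noteq> 0" "b \<noteq> 0" using d(3) by auto
    show "is_unit a \<or> is_unit b"
    proof (rule disjCI)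
      assume "\<not> is_unit b"
      with d(1) ab have "P b" by (auto simp: P_def dest: dvd_mult_right)
      with min nz have "degree a = 0" by (fastforce simp: ab degree_mult_eq)
      with nz show "is_unit a" by (simp add: is_unit_iff_degree)
    qed
  qed (use d in auto)
  then have "prime_elem d" by (rule field_poly_irreducible_imp_prime)
  with d(1) show thesis using e that dvd_trans by blast
qed

text \<open>A common prime divisor would divide X, hence also the constant term of \<open>f\<close>,
  which is a unit.\<close>

lemma coprime_monom:
  fixes f :: "'a::field poly"
  assumes "coeff f 0 \<noteq> 0" "c \<noteq> 0"
  shows "coprime f (monom c n)"
proof (rule ccontr)
  assume "\<not> coprime f (monom c n)"
  moreover have "f \<noteq> 0" using assms(1) by auto
  ultimately obtain d where d: "prime_elem d" "d dvd f" "d dvd monom c n"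
    by (rule not_coprime_prime_elem_divisor)
  have "d dvd [:0, 1:] ^ n"
    using d(3) assms(2) by (simp add: monom_altdef dvd_smult_iff)
  then have X: "d dvd [:0, 1:]"
    using d(1) prime_elem_dvd_power by blast
  obtain a g where f: "f = pCons a g" by (cases f)
  have "pCons a g = [:a:] + [:0, 1:] * g" by simp
  with d(2) X have "d dvd [:a:]"
    unfolding f by (metis dvd_add_left_iff dvd_mult2)
  moreover have "is_unit [:a:]"
    using assms(1) f by (simp add: is_unit_iff_degree)
  ultimately show False
    using d(1) dvd_unit_imp_unit prime_elem_not_unit by blast
qed

text \<open>Split off one prime \<open>d c\<close> at a time: the other primes do not divide it, so
  they divide the cofactor, and the degree drops by at least one. The induction runs over arbitrary
  \<open>f\<close> because the cofactor takes its place.\<close>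

lemma card_prime_divisors_le_degree:
  fixes f :: "'a::field poly"
  assumes "finite C" "f \<noteq> 0"
    and "\<And>c. c \<in> C \<Longrightarrow> prime_elem (d c)" "\<And>c. c \<in> C \<Longrightarrow> d c dvd f"
    and "\<And>b c. b \<in> C \<Longrightarrow> c \<in> C \<Longrightarrow> b \<noteq> c \<Longrightarrow> \<not> d b dvd d c"
  shows "card C \<le> degree f"
  using assms
proof (induction C arbitrary: f rule: finite_induct)
  case (insert c C)
  obtain g where f: "f = d c * g" using insert.prems(3)[of c] by auto
  have nz: "g \<noteq> 0" "d c \<noteq> 0" using f insert.prems(1) by auto
  have "d b dvd g" if "b \<in> C" for b
  proof -
    have "d b dvd d c * g" using that insert.prems(3) f by auto
    moreover have "\<not> d b dvd d c" using that insert.hyps insert.prems(4)[of b c] by auto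
    ultimately show ?thesis
      using prime_elem_dvd_mult_iff insert.prems(2) that by blast
  qed
  then have "card C \<le> degree g"
    using nz insert.prems by (intro insert.IH) auto
  moreover have "degree (d c) \<noteq> 0"
    using insert.prems(2)[of c] nz is_unit_iff_degree prime_elem_not_unit by blast
  ultimately show ?case
    using nz insert.hyps by (simp add: f degree_mult_eq)
qed auto

lemma card_not_coprime_le_degree:
  fixes f g :: "'a::{field,finite} poly"
  assumes "coeff f 0 \<noteq> 0"
  shows "card {c. \<not> coprime f (g + monom c n)} \<le> degree f"
proof -
  let ?C = "{c. \<not> coprime f (g + monom c n)}"
  have f: "f \<noteq> 0" using assms by auto
  have "\<forall>c\<in>?C. \<exists>d. prime_elem d \<and> d dvd f \<and> d dvd g + monom c n"
    using not_coprime_prime_elem_divisor[OF _ f] by blast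
  then obtain d where d: "\<And>c. c \<in> ?C \<Longrightarrow> prime_elem (d c) \<and> d c dvd f \<and> d c dvd g + monom c n"
    by metis
  \<comment> \<open>Distinct bad values thus yield non-associated primes dividing \<open>f\<close>,
    so counting primes bounds the number of bad values.\<close>
  have "\<not> d b dvd d c" if "b \<in> ?C" "c \<in> ?C" "b \<noteq> c" for b c
  proof
    assume "d b dvd d c"
    then have "d b dvd g + monom c n" using d[OF that(2)] dvd_trans by blast
    then have "d b dvd (g + monom c n) - (g + monom b n)"
      using d[OF that(1)] by (blast intro: dvd_diff)
    then have "d b dvd monom (c - b) n" by (simp add: diff_monom)
    moreover have "coprime f (monom (c - b) n)"
      using assms that(3) by (intro coprime_monom) auto
    ultimately have "is_unit (d b)"
      using d[OF that(1)] coprime_common_divisor by blast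
    then show False using d[OF that(1)] prime_elem_not_unit by blast
  qed
  then show ?thesis
    using f d by (intro card_prime_divisors_le_degree[where d = d]) auto
qed

lemma exists_coprime_extension:
  fixes f :: "nat \<Rightarrow> 'a::{field,finite} poly"
  assumes "N * (N - 1) < 2 * (CARD('a) - 1)"
    and deg: "\<And>m. degree (f m) \<le> m" and const: "\<And>m. coeff (f m) 0 \<noteq> 0"
  obtains c where "c \<noteq> 0" "\<And>m. m \<in> {1..N} \<Longrightarrow> coprime (f m) (f N + monom c (Suc N))"
proof -
  define B where "B m = {c. \<not> coprime (f m) (f N + monom c (Suc N))}" for m
  \<comment> \<open>The value 0 is excluded because the new coefficient must be non-zero. The index
    0 adds nothing to the bound, since \<open>f 0\<close> has degree 0. The index \<open>N\<close>
    is left out, as its degree bound would cost another \<open>N\<close> values.\<close>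
  have "card (insert 0 (\<Union>m<N. B m)) \<le> 1 + card (\<Union>m<N. B m)"
    by (simp add: card_insert_if)
  also have "card (\<Union>m<N. B m) \<le> (\<Sum>m<N. card (B m))"
    by (rule card_UN_le) simp
  also have "(\<Sum>m<N. card (B m)) \<le> (\<Sum>m<N. m)"
    unfolding B_def
    by (intro sum_mono order_trans[OF card_not_coprime_le_degree deg] const)
  also have "(\<Sum>m<N. m) = N * (N - 1) div 2"
    using Sum_Ico_nat[of 0 N] by (simp add: atLeast0LessThan)
  also have "1 + N * (N - 1) div 2 < CARD('a)"
    using assms(1) by linarith
  finally have "insert 0 (\<Union>m<N. B m) \<noteq> UNIV" by auto
  then obtain c where c: "c \<noteq> 0" "\<And>m. m < N \<Longrightarrow> c \<notin> B m" by blast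
  \<comment> \<open>A common divisor of both also divides the monomial, so any non-zero
    \<open>c\<close> works here.\<close>
  have "coprime (f N) (f N + monom c (Suc N))"
  proof -
    have "coprime (f N) (monom c (Suc N))" using c(1) const coprime_monom by blast
    then show ?thesis
      by (meson coprimeI coprime_common_divisor dvd_add_right_iff)
  qed
  with c show thesis
    by (intro that[of c]) (auto simp: B_def le_less)
qed

text \<open>The bound is the one for the last extension, from \<open>N - 1\<close> terms to
  \<open>N\<close>. Keeping \<open>u\<close> non-zero at every index gives all partial sums a
  non-zero constant term, as \<open>exists_coprime_extension\<close> requires.\<close>

lemma exists_pairwise_coprime_consecutive:
  assumes "(N - 1) * (N - 2) < 2 * (CARD('a::{field,finite}) - 1)"
  shows "\<exists>u :: nat \<Rightarrow> 'a. (\<forall>i. u i \<noteq> 0) \<and>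
    (\<forall>m\<in>{1..N}. \<forall>n\<in>{1..N}. m \<noteq> n \<longrightarrow>
      coprime (\<Sum>i\<le>m. monom (u i) i) (\<Sum>i\<le>n. monom (u i) i))"
  using assms
proof (induction N)
  case 0
  show ?case by (rule exI[of _ "\<lambda>_. 1"]) simp
next
  case (Suc N)
  have "(N - 1) * (N - 2) \<le> N * (N - 1)"
    by (metis diff_le_self mult.commute mult_le_mono2)
  also have "\<dots> < 2 * (CARD('a) - 1)" using Suc.prems by simp
  finally have "(N - 1) * (N - 2) < 2 * (CARD('a) - 1)" .
  from Suc.IH[OF this] obtain u :: "nat \<Rightarrow> 'a" where u: "\<And>i. u i \<noteq> 0" and
    cop: "\<And>m n. m \<in> {1..N} \<Longrightarrow> n \<in> {1..N} \<Longrightarrow> m \<noteq> n \<Longrightarrow>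
      coprime (\<Sum>i\<le>m. monom (u i) i) (\<Sum>i\<le>n. monom (u i) i)"
    by blast
  define f where "f v n = (\<Sum>i\<le>n. monom (v i) i)" for v :: "nat \<Rightarrow> 'a" and n
  have "degree (f u m) \<le> m" for m
    unfolding f_def by (intro degree_sum_le) (auto intro: order_trans[OF degree_monom_le])
  moreover have "coeff (f u m) 0 \<noteq> 0" for m
    using u by (simp add: f_def coeff_sum if_distrib cong: if_cong)
  moreover have "N * (N - 1) < 2 * (CARD('a) - 1)" using Suc.prems by simp
  ultimately obtain c where c: "c \<noteq> 0"
    "\<And>m. m \<in> {1..N} \<Longrightarrow> coprime (f u m) (f u N + monom c (Suc N))"
    using exists_coprime_extension[of N "f u"] by blast
  define v where "v = u(Suc N := c)"
  have old: "f v m = f u m" if "m \<le> N" for m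
    unfolding f_def v_def using that by (intro sum.cong) auto
  then have new: "f v (Suc N) = f u N + monom c (Suc N)"
    using old[of N] by (simp add: f_def v_def)
  have "coprime (f v m) (f v n)" if "m \<in> {1..Suc N}" "n \<in> {1..Suc N}" "m \<noteq> n" for m n
  proof (cases "m = Suc N \<or> n = Suc N")
    case True
    then show ?thesis
      using that c(2) by (auto simp: new old coprime_commute le_Suc_eq)
  next
    case False
    then show ?thesis
      using that cop[of m n] by (auto simp: old le_Suc_eq) (auto simp: f_def)
  qed
  moreover have "\<forall>i. v i \<noteq> 0" using u c(1) by (simp add: v_def)
  ultimately show ?case unfolding f_def by blast
qed

text \<open>With \<open>H = k + 2\<close> the summand 3/2 leaves k + 1/2 below the root. Its square
  is k(k+1) + 1/4, and the extra 1/4 makes the inequality strict.\<close>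

lemma floor_sqrt_length_bound:
  fixes q :: nat
  assumes "q \<ge> 2"
  defines "H \<equiv> nat \<lfloor>sqrt (2 * (real q - 1)) + 3 / 2\<rfloor>"
  shows "(H - 1) * (H - 2) < 2 * (q - 1)"
proof (cases "H \<ge> 2")
  case True
  then obtain k where k: "H = k + 2" by (metis add.commute le_Suc_ex)
  have "real H \<le> sqrt (2 * (real q - 1)) + 3 / 2"
    using assms(1) unfolding H_def by (simp add: of_nat_nat)
  then have "real k + 1 / 2 \<le> sqrt (2 * (real q - 1))" using k by simp
  then have "(real k + 1 / 2)\<^sup>2 \<le> 2 * (real q - 1)"
    using assms(1) power_mono[of "real k + 1 / 2" "sqrt (2 * (real q - 1))" 2] by simp
  then have "real k * (real k + 1) < 2 * (real q - 1)"
    by (simp add: power2_eq_square algebra_simps)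
  then have "real ((k + 1) * k) < real (2 * (q - 1))"
    using assms(1) by (simp add: of_nat_diff algebra_simps)
  then show ?thesis unfolding k of_nat_less_iff by simp
next
  case False
  then have "(H - 1) * (H - 2) = 0" by auto
  with assms(1) show ?thesis by linarith
qed

theorem theorem4p4:
  fixes p s q :: nat
  assumes "prime p" and "odd p" and "s \<ge> 1" and "q = p ^ s"
    and "CARD('a::{field,finite}) = q"
  shows "\<exists>(H::nat) (f :: nat \<Rightarrow> 'a poly).
           consecutive_poly_seq H f \<and>
           int H \<ge> \<lfloor>sqrt (2 * (real q - 1)) + 3 / 2\<rfloor> \<and>
           (\<forall>m\<in>{1..H}. \<forall>n\<in>{1..H}. m \<noteq> n \<longrightarrow> coprime (f m) (f n))"
proof -
  \<comment> \<open>The stated bound itself serves as the length; the greedy choice reaches it by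
    \<open>floor_sqrt_length_bound\<close>.\<close>
  define H where "H = nat \<lfloor>sqrt (2 * (real q - 1)) + 3 / 2\<rfloor>"
  have "card {0, 1 :: 'a} \<le> CARD('a)" by (intro card_mono) auto
  then have "q \<ge> 2" using assms(5) by simp
  then have "(H - 1) * (H - 2) < 2 * (CARD('a) - 1)"
    unfolding H_def assms(5) by (rule floor_sqrt_length_bound)
  from exists_pairwise_coprime_consecutive[OF this]
  obtain u :: "nat \<Rightarrow> 'a" where "\<forall>i. u i \<noteq> 0" and
    "\<forall>m\<in>{1..H}. \<forall>n\<in>{1..H}. m \<noteq> n \<longrightarrow>
      coprime (\<Sum>i\<le>m. monom (u i) i) (\<Sum>i\<le>n. monom (u i) i)"
    by blast
  moreover have "int H \<ge> \<lfloor>sqrt (2 * (real q - 1)) + 3 / 2\<rfloor>"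
    unfolding H_def by simp
  ultimately show ?thesis
    unfolding consecutive_poly_seq_def
    by (intro exI[of _ H] exI[of _ "\<lambda>n. \<Sum>i\<le>n. monom (u i) i"]) auto
qed

end
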